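(* Let $n,m\in\mathbb{N}$, $0\le a\le n$, $0\le b\le m$ and $0\le k\le n+m$. Given an $n$-symmetric kernel $\mathfrak{I}:\mathbb{X}_n\times\mathbb{X}_n\to\mathbb{R}$ and an $m$-symmetric kernel $\mathfrak{L}:\mathbb{Y}_m\times\mathbb{Y}_m\to\mathbb{R}$, consider the $(n+m)$-symmetric kernel $\mathfrak{I}\times\mathfrak{L}:[\mathbb{X}_n\times\mathbb{Y}_m]\times[\mathbb{X}_n\times\mathbb{Y}_m]\to\mathbb{R}$. Then $$\int_{\mathbb{X}_n\times\mathbb{Y}_m}\int_{\mathbb{X}_n\times\mathbb{Y}_m}(-1)^{a+b}\,\mathfrak{I}(x_{\vec 1},x_{\vec 2})\,\mathfrak{L}(y_{\vec 1},y_{\vec 2})\,d\mu(x_{\vec 1},y_{\vec 1})\,d\mu(x_{\vec 2},y_{\vec 2})>0$$ for every nonzero $\mu\in\mathcal{M}_{a,b}(\mathbb{X}_n,\mathbb{Y}_m)$ if and only if, for some $\ell\in\{0,1\}$, the kernel $(-1)^\ell\mathfrak{I}$ is $\mathrm{SPDI}_a$ in $\mathbb{X}_n$ and the kernel $(-1)^\ell\mathfrak{L}$ is $\mathrm{SPDI}_b$ in $\mathbb{Y}_m$.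
   Context: $X_1,\dots,X_n,Y_1,\dots,Y_m$ are nonempty sets; $\mathbb{X}_n=\prod_{i=1}^nX_i$, $\mathbb{Y}_m=\prod_{j=1}^mY_j$. $(\mathfrak{I}\times\mathfrak{L})((x,y),(x',y'))=\mathfrak{I}(x,x')\mathfrak{L}(y,y')$. For a product set $\mathbb{Z}$, $\mathcal{M}(\mathbb{Z})$ is the vector space of discrete (finitely supported) real signed measures on $\mathbb{Z}$. For $0\le k\le n$, $\mathcal{M}_k(\mathbb{X}_n)$ is the set of $\mu\in\mathcal{M}(\mathbb{X}_n)$ with $\mu(\prod_iA_i)=0$ whenever $A_i\subset X_i$ and $|\{i:A_i=X_i\}|\ge n-k+1$. $\mathcal{M}_{a,b}(\mathbb{X}_n,\mathbb{Y}_m)$ is the set of $\mu\in\mathcal{M}(\mathbb{X}_n\times\mathbb{Y}_m)$ such that, for $A_i\subset X_i$ and $B_j\subset Y_j$, $\mu\big([\prod_iA_i]\times[\prod_jB_j]\big)=0$ whenever $|\{i:A_i=X_i\}|\ge n-a+1$ or $|\{j:B_j=Y_j\}|\ge m-b+1$. A kernel $\mathfrak{I}$ on $\mathbb{X}_n$ is $n$-symmetric if $\mathfrak{I}(x_{\vec 1},x_{\vec 2})=\mathfrak{I}(x_\alpha,x_{\vec 3-\alpha})$ for all $\alpha\in\{1,2\}^n$ and all $x_{\vec 1},x_{\vec 2}\in\mathbb{X}_n$, where $x_{\vec a}=(x_1^a,\dots,x_n^a)$, $x_\alpha=(x_1^{\alpha_1},\dots,x_n^{\alpha_n})$ and $\vec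 3-\alpha=(3-\alpha_i)_i$. An $n$-symmetric kernel is $\mathrm{PDI}_k$ in $\mathbb{X}_n$ if $\iint(-1)^k\mathfrak{I}(u,v)\,d\mu(u)d\mu(v)\ge0$ for all $\mu\in\mathcal{M}_k(\mathbb{X}_n)$, and $\mathrm{SPDI}_k$ if moreover equality holds only for $\mu=0$.
   Formalization: Added hypothesis: M_a(X_n)={0} iff M_b(Y_m)={0} (e.g. all X_i, Y_j have at least two points). Without it the claim fails: for n=a=1, X_1 a singleton, m=1, b=0, |Y_1|=2 and L=0, the left side is vacuous but neither L nor -L is SPDI_0. *)

theory Defs
  imports Complex_Main "HOL-Library.FuncSet" "HOL-Library.Poly_Mapping"
begin

text \<open>
  The sets \<open>X\<^sub>1, \<dots>, X\<^sub>n\<close> are sets \<open>X i\<close>, \<open>i \<in> {1..n}\<close>, over one common type, and their product is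
  \<open>Pi\<^sub>E {1..n} X\<close>. A finitely supported signed measure is given by its point masses, that is, by an
  element of \<open>'z \<Rightarrow>\<^sub>0 real\<close> whose keys are the support.
\<close>

abbreviation prodset :: "nat \<Rightarrow> (nat \<Rightarrow> 'a set) \<Rightarrow> (nat \<Rightarrow> 'a) set" where
  "prodset n X \<equiv> Pi\<^sub>E {1..n} X"

definition dmeasures :: "'z set \<Rightarrow> ('z \<Rightarrow>\<^sub>0 real) set" where
  "dmeasures Z = {\<mu>. Poly_Mapping.keys \<mu> \<subseteq> Z}"

definition dmeasure :: "('z \<Rightarrow>\<^sub>0 real) \<Rightarrow> 'z set \<Rightarrow> real" where
  "dmeasure \<mu> A = (\<Sum>z \<in> Poly_Mapping.keys \<mu> \<inter> A. Poly_Mapping.lookup \<mu> z)"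

definition dintegral :: "('z \<Rightarrow>\<^sub>0 real) \<Rightarrow> ('z \<Rightarrow> real) \<Rightarrow> real" where
  "dintegral \<mu> f = (\<Sum>z \<in> Poly_Mapping.keys \<mu>. f z * Poly_Mapping.lookup \<mu> z)"

text \<open>\<open>\<M>\<^sub>k(\<X>\<^sub>n)\<close> and \<open>\<M>\<^sub>a\<^sub>,\<^sub>b(\<X>\<^sub>n, \<Y>\<^sub>m)\<close>; meant for \<open>k \<le> n\<close>, \<open>a \<le> n\<close>, \<open>b \<le> m\<close>, so the natural
  number subtractions do not truncate. For nonempty \<open>X i\<close>, \<open>Mk k n X = {0}\<close> iff fewer than \<open>k\<close> of the
  \<open>X i\<close> have two elements. If exactly one of \<open>Mk a n X\<close> and \<open>Mk b m Y\<close> is \<open>{0}\<close>, then \<open>Mab a b n X m Y = {0}\<close>,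
  so positivity on \<open>Mab\<close> is vacuous and implies nothing about the kernel on the nontrivial factor
  (which may be \<open>0\<close>). Statements deducing strict positivity on the factors have to exclude this case.\<close>

definition Mk :: "nat \<Rightarrow> nat \<Rightarrow> (nat \<Rightarrow> 'a set) \<Rightarrow> ((nat \<Rightarrow> 'a) \<Rightarrow>\<^sub>0 real) set" where
  "Mk k n X = {\<mu> \<in> dmeasures (prodset n X).
     \<forall>A. (\<forall>i\<in>{1..n}. A i \<subseteq> X i) \<and> card {i\<in>{1..n}. A i = X i} \<ge> n - k + 1
       \<longrightarrow> dmeasure \<mu> (prodset n A) = 0}"

definition Mab ::
  "nat \<Rightarrow> nat \<Rightarrow> nat \<Rightarrow> (nat \<Rightarrow> 'a set) \<Rightarrow> nat \<Rightarrow> (nat \<Rightarrow> 'b set)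
    \<Rightarrow> ((nat \<Rightarrow> 'a) \<times> (nat \<Rightarrow> 'b) \<Rightarrow>\<^sub>0 real) set" where
  "Mab a b n X m Y = {\<mu> \<in> dmeasures (prodset n X \<times> prodset m Y).
     \<forall>A B. (\<forall>i\<in>{1..n}. A i \<subseteq> X i) \<and> (\<forall>j\<in>{1..m}. B j \<subseteq> Y j) \<and>
       (card {i\<in>{1..n}. A i = X i} \<ge> n - a + 1 \<or> card {j\<in>{1..m}. B j = Y j} \<ge> m - b + 1)
       \<longrightarrow> dmeasure \<mu> (prodset n A \<times> prodset m B) = 0}"

text \<open>Below, \<open>x 1\<close> and \<open>x 2\<close> are the two points of the product, and \<open>x (\<alpha> i) i\<close> is the \<open>i\<close>-th
  coordinate of the point selected by \<open>\<alpha> i \<in> {1, 2}\<close>.\<close>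

definition n_symmetric ::
  "nat \<Rightarrow> (nat \<Rightarrow> 'a set) \<Rightarrow> ((nat \<Rightarrow> 'a) \<Rightarrow> (nat \<Rightarrow> 'a) \<Rightarrow> real) \<Rightarrow> bool" where
  "n_symmetric n X K \<longleftrightarrow>
     (\<forall>(x :: nat \<Rightarrow> nat \<Rightarrow> 'a) (\<alpha> :: nat \<Rightarrow> nat).
        x 1 \<in> prodset n X \<and> x 2 \<in> prodset n X \<and> (\<forall>i\<in>{1..n}. \<alpha> i \<in> {1, 2})
        \<longrightarrow> K (x 1) (x 2) = K (\<lambda>i\<in>{1..n}. x (\<alpha> i) i) (\<lambda>i\<in>{1..n}. x (3 - \<alpha> i) i))"

definition PDI ::
  "nat \<Rightarrow> nat \<Rightarrow> (nat \<Rightarrow> 'a set) \<Rightarrow> ((nat \<Rightarrow> 'a) \<Rightarrow> (nat \<Rightarrow> 'a) \<Rightarrow> real) \<Rightarrow> bool" where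
  "PDI k n X K \<longleftrightarrow> n_symmetric n X K \<and>
     (\<forall>\<mu> \<in> Mk k n X. dintegral \<mu> (\<lambda>v. dintegral \<mu> (\<lambda>u. (-1) ^ k * K u v)) \<ge> 0)"

definition SPDI ::
  "nat \<Rightarrow> nat \<Rightarrow> (nat \<Rightarrow> 'a set) \<Rightarrow> ((nat \<Rightarrow> 'a) \<Rightarrow> (nat \<Rightarrow> 'a) \<Rightarrow> real) \<Rightarrow> bool" where
  "SPDI k n X K \<longleftrightarrow> PDI k n X K \<and>
     (\<forall>\<mu> \<in> Mk k n X. dintegral \<mu> (\<lambda>v. dintegral \<mu> (\<lambda>u. (-1) ^ k * K u v)) = 0 \<longrightarrow> \<mu> = 0)"

definition prod_kernel ::
  "('x \<Rightarrow> 'x \<Rightarrow> real) \<Rightarrow> ('y \<Rightarrow> 'y \<Rightarrow> real) \<Rightarrow> 'x \<times> 'y \<Rightarrow> 'x \<times> 'y \<Rightarrow> real" where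
  "prod_kernel K L = (\<lambda>(x, y) (x', y'). K x x' * L y y')"

end

theory Submission
  imports Defs
begin

text \<open>A measure lies in \<open>\<M>\<^sub>a\<^sub>,\<^sub>b\<close> iff its slices lie in \<open>\<M>\<^sub>a\<close> and in \<open>\<M>\<^sub>b\<close>, so \<open>\<M>\<^sub>a\<^sub>,\<^sub>b\<close> is the tensor product
  of these spaces. Positivity of the two factors gives positivity of the product form by the argument
  of the Schur product theorem: diagonalise the Gram matrix of the slices. Conversely, the energy of
  a product measure is the product of the energies; if it is always positive, then all energies on
  both factors have the same sign.\<close>

section \<open>Positive semidefinite matrices\<close>

text \<open>Moving along the coordinate vector of \<open>d\<close>, written
  \<open>of_bool (s = d)\<close>, makes the form a quadratic polynomial in \<open>x\<close>;
  symmetry merges the two cross terms. It serves to test diagonal entries and to complete the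
  square.\<close>

lemma quadratic_form_shift:
  fixes G :: "'s \<Rightarrow> 's \<Rightarrow> real"
  assumes S: "finite S" "d \<in> S" and sym: "\<And>s t. s \<in> S \<Longrightarrow> t \<in> S \<Longrightarrow> G s t = G t s"
  shows "(\<Sum>s\<in>S. \<Sum>t\<in>S. (f s + x * of_bool (s = d)) * (f t + x * of_bool (t = d)) * G s t)
    = (\<Sum>s\<in>S. \<Sum>t\<in>S. f s * f t * G s t) + 2 * x * (\<Sum>t\<in>S. f t * G d t) + x\<^sup>2 * G d d"
proof -
  have eq: "(\<Sum>s\<in>S. (of_bool (s = d) :: real) * g s) = g d" for g :: "'s \<Rightarrow> real"
    using S by (simp add: sum.delta of_bool_def if_distrib[where f="\<lambda>c. c * _"] cong: if_cong)
  have "(\<Sum>s\<in>S. \<Sum>t\<in>S. (f s + x * of_bool (s = d)) * (f t + x * of_bool (t = d)) * G s t)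
    = (\<Sum>s\<in>S. \<Sum>t\<in>S. f s * f t * G s t)
      + x * (\<Sum>s\<in>S. of_bool (s = d) * (\<Sum>t\<in>S. f t * G s t))
      + x * (\<Sum>s\<in>S. f s * (\<Sum>t\<in>S. of_bool (t = d) * G s t))
      + x\<^sup>2 * (\<Sum>s\<in>S. of_bool (s = d) * (\<Sum>t\<in>S. of_bool (t = d) * G s t))"
    by (simp add: sum_distrib_left sum.distrib algebra_simps power2_eq_square)
  also have "\<dots> = (\<Sum>s\<in>S. \<Sum>t\<in>S. f s * f t * G s t) + x * (\<Sum>t\<in>S. f t * G d t)
      + x * (\<Sum>s\<in>S. f s * G s d) + x\<^sup>2 * G d d"
    by (simp only: eq)
  also have "(\<Sum>s\<in>S. f s * G s d) = (\<Sum>t\<in>S. f t * G d t)"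
    using S sym by (intro sum.cong) auto
  finally show ?thesis by simp
qed

text \<open>With a zero diagonal entry the form is affine in the coordinate \<open>d\<close>, and an
  affine function bounded below has slope zero.\<close>

lemma psd_zero_diagonal:
  fixes G :: "'s \<Rightarrow> 's \<Rightarrow> real"
  assumes S: "finite S" "d \<in> S" "t \<in> S"
    and sym: "\<And>s t. s \<in> S \<Longrightarrow> t \<in> S \<Longrightarrow> G s t = G t s"
    and psd: "\<And>f. (\<Sum>s\<in>S. \<Sum>t\<in>S. f s * f t * G s t) \<ge> 0"
    and zero: "G d d = 0"
  shows "G d t = 0"
proof (rule ccontr)
  assume nz: "G d t \<noteq> 0"
  define f :: "'s \<Rightarrow> real" where "f = (\<lambda>s. of_bool (s = t))"
  have row: "(\<Sum>u\<in>S. f u * g u) = g t" for g :: "'s \<Rightarrow> real"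
    unfolding f_def
    using S by (simp add: sum.delta of_bool_def if_distrib[where f="\<lambda>c. c * _"] cong: if_cong)
  have Q: "(\<Sum>s\<in>S. \<Sum>u\<in>S. f s * f u * G s u) = G t t"
    using row by (simp add: mult.assoc flip: sum_distrib_left)
  \<comment> \<open>Chosen so that \<open>G t t + 2 * x * G d t = -1\<close>, which contradicts
    nonnegativity.\<close>
  define x where "x = - (G t t + 1) / (2 * G d t)"
  have "0 \<le> G t t + 2 * x * G d t + x\<^sup>2 * G d d"
    using psd[of "\<lambda>s. f s + x * of_bool (s = d)"]
    by (simp only: quadratic_form_shift[OF S(1,2) sym] Q row)
  then show False
    using nz zero by (simp add: x_def field_simps)
qed

text \<open>The vectors \<open>c r\<close> arise by splitting off one Schur complement after the other; it matters
  that they lie in the row space of \<open>G\<close>.\<close>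

lemma psd_rank_one_decomposition:
  fixes G :: "'s \<Rightarrow> 's \<Rightarrow> real"
  assumes "finite D" and "finite S" and "D \<subseteq> S"
    and "\<And>s t. s \<in> S \<Longrightarrow> t \<in> S \<Longrightarrow> G s t = G t s"
    and "\<And>f. (\<Sum>s\<in>S. \<Sum>t\<in>S. f s * f t * G s t) \<ge> 0"
    and "\<And>s t. s \<in> S - D \<Longrightarrow> t \<in> S \<Longrightarrow> G s t = 0"
  shows "\<exists>c w. (\<forall>s\<in>S. \<forall>t\<in>S. G s t = (\<Sum>r\<in>D. c r s * c r t)) \<and>
    (\<forall>r\<in>D. \<forall>t\<in>S. c r t = (\<Sum>s\<in>S. w r s * G s t))"
  using assms
proof (induction D arbitrary: G rule: finite_induct)
  case empty
  then show ?case by simp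
next
  case (insert d D)
  note sym = insert.prems(3) and psd = insert.prems(4)
  have S: "finite S" "d \<in> S" using insert.prems by auto
  show ?case
  proof (cases "G d d = 0")
    case True
    \<comment> \<open>A zero pivot forces all of row \<open>d\<close> to vanish, so the induction
      hypothesis applies to \<open>G\<close> itself, and the index \<open>d\<close> receives the
      zero vector.\<close>
    have zero: "G s t = 0" if "s \<in> S - D" "t \<in> S" for s t
      using that insert.prems(5) psd_zero_diagonal[OF S _ sym psd True] by (cases "s = d") auto
    obtain c w where
      c: "\<forall>s\<in>S. \<forall>t\<in>S. G s t = (\<Sum>r\<in>D. c r s * c r t)" and
      w: "\<forall>r\<in>D. \<forall>t\<in>S. c r t = (\<Sum>s\<in>S. w r s * G s t)"
      using insert.IH[OF S(1) _ sym psd zero] insert.prems(2) by blast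
    define c' where "c' = c(d := \<lambda>_. 0)"
    define w' where "w' = w(d := \<lambda>_. 0)"
    have "(\<Sum>r\<in>insert d D. c' r s * c' r t) = (\<Sum>r\<in>D. c r s * c r t)" for s t
      using insert.hyps by (auto simp: c'_def intro: sum.cong)
    then have "\<forall>s\<in>S. \<forall>t\<in>S. G s t = (\<Sum>r\<in>insert d D. c' r s * c' r t)"
      using c by presburger
    moreover have "c' r t = (\<Sum>s\<in>S. w' r s * G s t)" if "r \<in> insert d D" "t \<in> S" for r t
    proof (cases "r = d")
      case False
      then have "c r t = (\<Sum>s\<in>S. w r s * G s t)" using w that by blast
      moreover have "c' r = c r" "w' r = w r" using False by (simp_all add: c'_def w'_def)
      ultimately show ?thesis by (simp only:)
    qed (simp add: c'_def w'_def)
    ultimately show ?thesis by blast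
  next
    case False
    define g where "g = G d d"
    \<comment> \<open>Shifting the zero vector by one unit evaluates the form at the coordinate
      vector of \<open>d\<close>.\<close>
    have "0 \<le> g"
      using psd[of "\<lambda>s. 0 + 1 * of_bool (s = d)"]
      by (subst (asm) quadratic_form_shift[OF S sym]) (simp_all add: g_def)
    with False have g: "g > 0" by (simp add: g_def)
    \<comment> \<open>The Schur complement of the pivot \<open>g\<close>: subtracting this rank-one
      matrix clears row \<open>d\<close>, so only rows in \<open>D\<close> can be nonzero.\<close>
    define G' where "G' = (\<lambda>s t. G s t - G d s * G d t / g)"
    have sym': "G' s t = G' t s" if "s \<in> S" "t \<in> S" for s t
      using sym[OF that] by (simp add: G'_def)
    have psd': "(\<Sum>s\<in>S. \<Sum>t\<in>S. f s * f t * G' s t) \<ge> 0" for f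
    proof -
      \<comment> \<open>The shift \<open>- p / g\<close> minimises the form of \<open>G\<close>
        along the coordinate \<open>d\<close>; the minimum equals the form of \<open>G'\<close> at
        \<open>f\<close>, which is therefore nonnegative.\<close>
      define p where "p = (\<Sum>t\<in>S. f t * G d t)"
      have "(\<Sum>s\<in>S. \<Sum>t\<in>S. f s * f t * G' s t)
        = (\<Sum>s\<in>S. \<Sum>t\<in>S. f s * f t * G s t) - (\<Sum>s\<in>S. \<Sum>t\<in>S. (f s * G d s) * (f t * G d t) / g)"
        by (simp add: G'_def sum_subtractf algebra_simps)
      also have "(\<Sum>s\<in>S. \<Sum>t\<in>S. (f s * G d s) * (f t * G d t) / g) = p\<^sup>2 / g"
        by (simp add: p_def power2_eq_square sum_product sum_divide_distrib)
      also have "(\<Sum>s\<in>S. \<Sum>t\<in>S. f s * f t * G s t) - p\<^sup>2 / g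
        = (\<Sum>s\<in>S. \<Sum>t\<in>S. f s * f t * G s t) + 2 * (- p / g) * p + (- p / g)\<^sup>2 * G d d"
        using g by (simp add: power2_eq_square flip: g_def)
      also have "\<dots> = (\<Sum>s\<in>S. \<Sum>t\<in>S. (f s + (- p / g) * of_bool (s = d)) * (f t + (- p / g) * of_bool (t = d)) * G s t)"
        by (subst quadratic_form_shift[OF S sym]) (simp_all add: p_def)
      finally show ?thesis using psd by simp
    qed
    have zero: "G' s t = 0" if "s \<in> S - D" "t \<in> S" for s t
    proof (cases "s = d")
      case True
      then show ?thesis using g by (simp add: G'_def flip: g_def)
    next
      case False
      then have "G s t = 0" "G s d = 0" using that S insert.prems(5) by auto
      moreover have "G d s = G s d" using sym that S by blast
      ultimately show ?thesis by (simp add: G'_def)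
    qed
    obtain c w where
      c: "\<forall>s\<in>S. \<forall>t\<in>S. G' s t = (\<Sum>r\<in>D. c r s * c r t)" and
      w: "\<forall>r\<in>D. \<forall>t\<in>S. c r t = (\<Sum>s\<in>S. w r s * G' s t)"
      using insert.IH[OF S(1) _ sym' psd' zero] insert.prems(2) by blast
    \<comment> \<open>The outer square of the vector at \<open>d\<close> is the rank-one matrix that
      was split off.\<close>
    define c' where "c' = c(d := \<lambda>s. G d s / sqrt g)"
    \<comment> \<open>Rows of \<open>G'\<close> are rows of \<open>G\<close> minus multiples of row
      \<open>d\<close>. A combination of the former becomes one of the latter once the coefficient
      at \<open>d\<close> absorbs these multiples. For \<open>r = d\<close>, row \<open>d\<close> is
      selected and rescaled.\<close>
    define w' where "w' = (\<lambda>r. if r = d then (\<lambda>s. of_bool (s = d) / sqrt g)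
      else (\<lambda>s. w r s - of_bool (s = d) * ((\<Sum>u\<in>S. w r u * G d u) / g)))"
    have delta: "(\<Sum>s\<in>S. (of_bool (s = d) :: real) * h s) = h d" for h :: "'s \<Rightarrow> real"
      using S by (simp add: sum.delta of_bool_def if_distrib[where f="\<lambda>c. c * _"] cong: if_cong)
    have "G s t = (\<Sum>r\<in>insert d D. c' r s * c' r t)" if "s \<in> S" "t \<in> S" for s t
    proof -
      have "(\<Sum>r\<in>D. c' r s * c' r t) = G' s t"
        using insert.hyps(2) c that by (auto simp: c'_def intro: sum.cong)
      moreover have "c' d s * c' d t = G d s * G d t / g"
        using g by (simp add: c'_def)
      ultimately show ?thesis using insert.hyps by (simp add: G'_def)
    qed
    moreover have "c' r t = (\<Sum>s\<in>S. w' r s * G s t)" if "r \<in> insert d D" "t \<in> S" for r t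
    proof (cases "r = d")
      case True
      have "(\<Sum>s\<in>S. w' r s * G s t) = (\<Sum>s\<in>S. of_bool (s = d) * (G s t / sqrt g))"
        using True by (simp add: w'_def)
      then show ?thesis using True by (simp only: delta) (simp add: c'_def)
    next
      case False
      define q where "q = (\<Sum>u\<in>S. w r u * G d u) / g"
      have "(\<Sum>s\<in>S. w' r s * G s t)
        = (\<Sum>s\<in>S. w r s * G s t) - (\<Sum>s\<in>S. of_bool (s = d) * (q * G s t))"
        using False by (simp add: w'_def left_diff_distrib sum_subtractf mult.assoc flip: q_def)
      also have "\<dots> = (\<Sum>s\<in>S. w r s * G s t) - q * G d t" by (simp only: delta)
      also have "q * G d t = (\<Sum>s\<in>S. w r s * (G d s * G d t / g))"
        by (simp add: q_def sum_divide_distrib sum_distrib_left sum_distrib_right mult_ac)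
      also have "(\<Sum>s\<in>S. w r s * G s t) - \<dots> = (\<Sum>s\<in>S. w r s * G' s t)"
        by (simp add: G'_def right_diff_distrib sum_subtractf)
      finally show ?thesis using w that False by (simp add: c'_def)
    qed
    ultimately show ?thesis by blast
  qed
qed

section \<open>Measures, slices and products\<close>

lemma dintegral_superset:
  assumes "finite S" "Poly_Mapping.keys \<mu> \<subseteq> S"
  shows "dintegral \<mu> f = (\<Sum>z\<in>S. f z * Poly_Mapping.lookup \<mu> z)"
  unfolding dintegral_def using assms
  by (intro sum.mono_neutral_left) (auto simp: in_keys_iff)

lemma dmeasure_superset:
  assumes "finite S" "Poly_Mapping.keys \<mu> \<subseteq> S"
  shows "dmeasure \<mu> A = (\<Sum>z\<in>S. of_bool (z \<in> A) * Poly_Mapping.lookup \<mu> z)"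
proof -
  have "(\<Sum>z\<in>S. of_bool (z \<in> A) * Poly_Mapping.lookup \<mu> z)
    = (\<Sum>z\<in>Poly_Mapping.keys \<mu> \<inter> A. of_bool (z \<in> A) * Poly_Mapping.lookup \<mu> z)"
    using assms by (intro sum.mono_neutral_right) (auto simp: in_keys_iff)
  then show ?thesis by (simp add: dmeasure_def)
qed

section \<open>Energies and linear spaces of measures\<close>

definition energy :: "('z \<Rightarrow> 'z \<Rightarrow> real) \<Rightarrow> ('z \<Rightarrow>\<^sub>0 real) \<Rightarrow> real" where
  "energy K \<mu> = dintegral \<mu> (\<lambda>v. dintegral \<mu> (\<lambda>u. K u v))"

lemma energy_superset:
  assumes "finite S" "Poly_Mapping.keys \<mu> \<subseteq> S"
  shows "energy K \<mu> = (\<Sum>v\<in>S. \<Sum>u\<in>S. K u v * Poly_Mapping.lookup \<mu> u * Poly_Mapping.lookup \<mu> v)"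
  by (simp add: energy_def dintegral_superset[OF assms] sum_distrib_right)

lemma energy_zero [simp]: "energy K 0 = 0"
  by (simp add: energy_def dintegral_def)

lemma energy_scale: "energy (\<lambda>u v. c * K u v) \<mu> = c * energy K \<mu>"
  by (simp add: energy_superset[OF finite_keys subset_refl] sum_distrib_left mult_ac)

definition positive_on :: "('z \<Rightarrow>\<^sub>0 real) set \<Rightarrow> ('z \<Rightarrow> 'z \<Rightarrow> real) \<Rightarrow> bool" where
  "positive_on U K \<longleftrightarrow> (\<forall>\<mu>\<in>U. \<mu> \<noteq> 0 \<longrightarrow> energy K \<mu> > 0)"

definition scale :: "real \<Rightarrow> ('z \<Rightarrow>\<^sub>0 real) \<Rightarrow> ('z \<Rightarrow>\<^sub>0 real)" where
  "scale c = Poly_Mapping.map ((*) c)"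

lemma lookup_scale [simp]: "Poly_Mapping.lookup (scale c \<mu>) z = c * Poly_Mapping.lookup \<mu> z"
  by (simp add: scale_def Poly_Mapping.map.rep_eq when_def)

text \<open>The case \<open>\<mu> = 0\<close> gives closure under scaling and \<open>c = 1\<close>
  closure under addition, so these are the linear subspaces.\<close>

definition linear_space :: "('z \<Rightarrow>\<^sub>0 real) set \<Rightarrow> bool" where
  "linear_space U \<longleftrightarrow> 0 \<in> U \<and> (\<forall>\<mu>\<in>U. \<forall>\<nu>\<in>U. \<forall>c. \<mu> + scale c \<nu> \<in> U)"

lemma linear_space_sum:
  assumes U: "linear_space U" and "finite F" "\<And>x. x \<in> F \<Longrightarrow> s x \<in> U"
  shows "(\<Sum>x\<in>F. scale (h x) (s x)) \<in> U"
  using assms(2,3)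
proof (induction F rule: finite_induct)
  case empty
  then show ?case using U by (simp add: linear_space_def)
next
  case (insert x F)
  then have "(\<Sum>x\<in>F. scale (h x) (s x)) + scale (h x) (s x) \<in> U"
    using U by (simp add: linear_space_def)
  then show ?case using insert.hyps by (simp add: add.commute)
qed

lemma linear_space_scale: "linear_space U \<Longrightarrow> \<mu> \<in> U \<Longrightarrow> scale c \<mu> \<in> U"
  using linear_space_sum[of U "{()}" "\<lambda>_. \<mu>" "\<lambda>_. c"] by simp

section \<open>Slices and product measures\<close>

definition slice_fst :: "('x \<times> 'y \<Rightarrow>\<^sub>0 real) \<Rightarrow> 'y \<Rightarrow> ('x \<Rightarrow>\<^sub>0 real)" where
  "slice_fst \<mu> y = Abs_poly_mapping (\<lambda>x. Poly_Mapping.lookup \<mu> (x, y))"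

definition slice_snd :: "('x \<times> 'y \<Rightarrow>\<^sub>0 real) \<Rightarrow> 'x \<Rightarrow> ('y \<Rightarrow>\<^sub>0 real)" where
  "slice_snd \<mu> x = Abs_poly_mapping (\<lambda>y. Poly_Mapping.lookup \<mu> (x, y))"

definition tensor :: "('x \<Rightarrow>\<^sub>0 real) \<Rightarrow> ('y \<Rightarrow>\<^sub>0 real) \<Rightarrow> ('x \<times> 'y \<Rightarrow>\<^sub>0 real)" where
  "tensor u v = Abs_poly_mapping (\<lambda>(x, y). Poly_Mapping.lookup u x * Poly_Mapping.lookup v y)"

text \<open>The support of a slice lies in a projection of the finite support of
  \<open>\<mu>\<close>; this finiteness makes \<open>Abs_poly_mapping\<close> represent the given
  function.\<close>

lemma lookup_slice_fst [simp]: "Poly_Mapping.lookup (slice_fst \<mu> y) x = Poly_Mapping.lookup \<mu> (x, y)"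
proof -
  have "{x. Poly_Mapping.lookup \<mu> (x, y) \<noteq> 0} \<subseteq> fst ` Poly_Mapping.keys \<mu>"
    by (force simp: in_keys_iff)
  then have "finite {x. Poly_Mapping.lookup \<mu> (x, y) \<noteq> 0}"
    by (rule finite_subset) simp
  then show ?thesis by (simp add: slice_fst_def)
qed

lemma lookup_slice_snd [simp]: "Poly_Mapping.lookup (slice_snd \<mu> x) y = Poly_Mapping.lookup \<mu> (x, y)"
proof -
  have "{y. Poly_Mapping.lookup \<mu> (x, y) \<noteq> 0} \<subseteq> snd ` Poly_Mapping.keys \<mu>"
    by (force simp: in_keys_iff)
  then have "finite {y. Poly_Mapping.lookup \<mu> (x, y) \<noteq> 0}"
    by (rule finite_subset) simp
  then show ?thesis by (simp add: slice_snd_def)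
qed

lemma lookup_tensor [simp]:
  "Poly_Mapping.lookup (tensor u v) (x, y) = Poly_Mapping.lookup u x * Poly_Mapping.lookup v y"
proof -
  have "{z. (case z of (x, y) \<Rightarrow> Poly_Mapping.lookup u x * Poly_Mapping.lookup v y) \<noteq> 0}
      \<subseteq> Poly_Mapping.keys u \<times> Poly_Mapping.keys v"
    by (auto simp: in_keys_iff)
  then have "finite {z. (case z of (x, y) \<Rightarrow> Poly_Mapping.lookup u x * Poly_Mapping.lookup v y) \<noteq> 0}"
    by (rule finite_subset) simp
  then show ?thesis by (simp add: tensor_def)
qed

lemma keys_slice_fst: "Poly_Mapping.keys (slice_fst \<mu> y) \<subseteq> fst ` Poly_Mapping.keys \<mu>"
  by (force simp: in_keys_iff)

lemma keys_slice_snd: "Poly_Mapping.keys (slice_snd \<mu> x) \<subseteq> snd ` Poly_Mapping.keys \<mu>"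
  by (force simp: in_keys_iff)

lemma keys_tensor: "Poly_Mapping.keys (tensor u v) \<subseteq> Poly_Mapping.keys u \<times> Poly_Mapping.keys v"
  by (auto simp: in_keys_iff)

lemma slice_fst_tensor: "slice_fst (tensor u v) y = scale (Poly_Mapping.lookup v y) u"
  by (rule poly_mapping_eqI) simp

lemma slice_snd_tensor: "slice_snd (tensor u v) x = scale (Poly_Mapping.lookup u x) v"
  by (rule poly_mapping_eqI) simp

lemma tensor_nonzero:
  assumes "u \<noteq> 0" "v \<noteq> 0"
  shows "tensor u v \<noteq> 0"
proof -
  obtain x y where "Poly_Mapping.lookup u x \<noteq> 0" "Poly_Mapping.lookup v y \<noteq> 0"
    using assms by (metis lookup_zero poly_mapping_eqI)
  then have "Poly_Mapping.lookup (tensor u v) (x, y) \<noteq> 0" by simp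
  then show ?thesis by (metis lookup_zero)
qed

text \<open>Summing over first coordinates inside exhibits the Gram matrix, under \<open>P\<close>,
  of the slices with fixed second coordinate, paired with the matrix \<open>Q\<close>.\<close>

lemma energy_product:
  assumes "finite A" "finite B" "Poly_Mapping.keys \<mu> \<subseteq> A \<times> B"
  shows "energy (prod_kernel P Q) \<mu> = (\<Sum>y'\<in>B. \<Sum>y\<in>B. Q y y' *
    (\<Sum>x'\<in>A. \<Sum>x\<in>A. P x x' * Poly_Mapping.lookup \<mu> (x, y) * Poly_Mapping.lookup \<mu> (x', y')))"
proof -
  define t where "t = (\<lambda>x y x' y'. P x x' * Q y y' * Poly_Mapping.lookup \<mu> (x, y) * Poly_Mapping.lookup \<mu> (x', y'))"
  have "energy (prod_kernel P Q) \<mu> = (\<Sum>x'\<in>A. \<Sum>y'\<in>B. \<Sum>x\<in>A. \<Sum>y\<in>B. t x y x' y')"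
    using assms by (simp add: energy_superset[of "A \<times> B"] prod_kernel_def sum.cartesian_product'
      t_def split_def)
  also have "\<dots> = (\<Sum>y'\<in>B. \<Sum>x'\<in>A. \<Sum>y\<in>B. \<Sum>x\<in>A. t x y x' y')"
    by (subst sum.swap) (intro sum.cong refl sum.swap)
  also have "\<dots> = (\<Sum>y'\<in>B. \<Sum>y\<in>B. \<Sum>x'\<in>A. \<Sum>x\<in>A. t x y x' y')"
    by (intro sum.cong refl sum.swap)
  finally show ?thesis by (simp add: t_def sum_distrib_left mult_ac)
qed

text \<open>All slices of a product measure are multiples of \<open>u\<close>, so their Gram matrix
  is \<open>energy P u\<close> times the products of point masses of \<open>v\<close>.\<close>

lemma energy_tensor: "energy (prod_kernel P Q) (tensor u v) = energy P u * energy Q v"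
proof -
  let ?A = "Poly_Mapping.keys u" and ?B = "Poly_Mapping.keys v"
  have "energy (prod_kernel P Q) (tensor u v) = (\<Sum>y'\<in>?B. \<Sum>y\<in>?B. Q y y' *
     (Poly_Mapping.lookup v y * Poly_Mapping.lookup v y' * energy P u))"
    by (simp add: energy_product[OF _ _ keys_tensor] energy_superset[OF finite_keys subset_refl, of P]
      sum_distrib_left mult_ac)
  also have "\<dots> = energy P u * energy Q v"
    by (simp add: energy_superset[OF finite_keys subset_refl, of Q] sum_distrib_left mult_ac)
  finally show ?thesis .
qed

text \<open>For linear spaces this is the algebraic tensor product. Describing it by slices avoids
  representing elements as sums of product measures.\<close>

definition tensor_space :: "('x \<Rightarrow>\<^sub>0 real) set \<Rightarrow> ('y \<Rightarrow>\<^sub>0 real) set \<Rightarrow> ('x \<times> 'y \<Rightarrow>\<^sub>0 real) set" where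
  "tensor_space U V = {\<mu>. (\<forall>y. slice_fst \<mu> y \<in> U) \<and> (\<forall>x. slice_snd \<mu> x \<in> V)}"

lemma tensor_in_tensor_space:
  assumes "linear_space U" "linear_space V" "u \<in> U" "v \<in> V"
  shows "tensor u v \<in> tensor_space U V"
  using assms by (simp add: tensor_space_def slice_fst_tensor slice_snd_tensor linear_space_scale)

text \<open>On a span, the energy is the quadratic form of the Gram matrix of the spanning measures.
  This turns positivity on \<open>U\<close> into positive semidefiniteness of a matrix.\<close>

lemma energy_linear_combination:
  assumes A: "finite A" "\<And>s. s \<in> S \<Longrightarrow> Poly_Mapping.keys (u s) \<subseteq> A"
  shows "energy P (\<Sum>s\<in>S. scale (f s) (u s)) = (\<Sum>t\<in>S. \<Sum>s\<in>S. f s * f t *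
    (\<Sum>x'\<in>A. \<Sum>x\<in>A. P x x' * Poly_Mapping.lookup (u s) x * Poly_Mapping.lookup (u t) x'))"
proof -
  let ?l = "\<lambda>s. Poly_Mapping.lookup (u s)"
  have l: "Poly_Mapping.lookup (\<Sum>s\<in>S. scale (f s) (u s)) x = (\<Sum>s\<in>S. f s * ?l s x)" for x
    by (simp add: lookup_sum)
  have "Poly_Mapping.keys (\<Sum>s\<in>S. scale (f s) (u s)) \<subseteq> A"
  proof
    fix x assume "x \<in> Poly_Mapping.keys (\<Sum>s\<in>S. scale (f s) (u s))"
    then have "(\<Sum>s\<in>S. f s * ?l s x) \<noteq> 0" by (simp add: in_keys_iff l)
    then obtain s where s: "s \<in> S" "?l s x \<noteq> 0"
      by (auto elim: sum.not_neutral_contains_not_neutral)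
    then show "x \<in> A" using A(2)[OF s(1)] by (auto simp: in_keys_iff)
  qed
  then have "energy P (\<Sum>s\<in>S. scale (f s) (u s))
      = (\<Sum>x'\<in>A. \<Sum>x\<in>A. P x x' * (\<Sum>s\<in>S. f s * ?l s x) * (\<Sum>t\<in>S. f t * ?l t x'))"
    by (simp add: energy_superset[OF A(1)] l)
  also have "\<dots> = (\<Sum>x'\<in>A. \<Sum>x\<in>A. \<Sum>t\<in>S. \<Sum>s\<in>S. f s * f t * (P x x' * ?l s x * ?l t x'))"
    by (intro sum.cong refl, subst sum.swap) (simp add: sum_distrib_left sum_distrib_right mult_ac)
  also have "\<dots> = (\<Sum>x'\<in>A. \<Sum>t\<in>S. \<Sum>x\<in>A. \<Sum>s\<in>S. f s * f t * (P x x' * ?l s x * ?l t x'))"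
    by (rule sum.cong[OF refl], rule sum.swap)
  also have "\<dots> = (\<Sum>t\<in>S. \<Sum>x'\<in>A. \<Sum>x\<in>A. \<Sum>s\<in>S. f s * f t * (P x x' * ?l s x * ?l t x'))"
    by (rule sum.swap)
  also have "\<dots> = (\<Sum>t\<in>S. \<Sum>x'\<in>A. \<Sum>s\<in>S. \<Sum>x\<in>A. f s * f t * (P x x' * ?l s x * ?l t x'))"
    by (rule sum.cong[OF refl], rule sum.cong[OF refl], rule sum.swap)
  also have "\<dots> = (\<Sum>t\<in>S. \<Sum>s\<in>S. \<Sum>x'\<in>A. \<Sum>x\<in>A. f s * f t * (P x x' * ?l s x * ?l t x'))"
    by (rule sum.cong[OF refl], rule sum.swap)
  finally show ?thesis by (simp add: sum_distrib_left)
qed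

text \<open>The Gram matrix of the slices \<open>\<mu>(\<cdot>, y)\<close> decomposes as \<open>\<Sum>r. c r y * c r y'\<close>. As \<open>c r\<close> lies in its
  row space, it is a linear combination of slices \<open>\<mu>(x, \<cdot>)\<close>, hence an element of \<open>V\<close>, and the energy
  of \<open>\<mu>\<close> is the sum of the energies of the \<open>c r\<close>.\<close>

lemma positive_on_tensor_space:
  assumes U: "linear_space U" "positive_on U P" and V: "linear_space V" "positive_on V Q"
    and Z: "U \<subseteq> dmeasures Z" and sym: "\<And>x x'. x \<in> Z \<Longrightarrow> x' \<in> Z \<Longrightarrow> P x x' = P x' x"
  shows "positive_on (tensor_space U V) (prod_kernel P Q)"
  unfolding positive_on_def
proof (intro ballI impI)
  fix \<mu> assume \<mu>: "\<mu> \<in> tensor_space U V" "\<mu> \<noteq> 0"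
  let ?l = "Poly_Mapping.lookup \<mu>"
  define A where "A = fst ` Poly_Mapping.keys \<mu>"
  define B where "B = snd ` Poly_Mapping.keys \<mu>"
  define G where "G = (\<lambda>y y'. \<Sum>x'\<in>A. \<Sum>x\<in>A. P x x' * ?l (x, y) * ?l (x', y'))"
  have fin: "finite A" "finite B" by (simp_all add: A_def B_def)
  have keys: "Poly_Mapping.keys \<mu> \<subseteq> A \<times> B" by (force simp: A_def B_def)
  have fstU: "slice_fst \<mu> y \<in> U" and sndV: "slice_snd \<mu> x \<in> V" for x y
    using \<mu> by (auto simp: tensor_space_def)
  \<comment> \<open>Symmetry of \<open>P\<close> is available on \<open>Z\<close> only; the slices
    in \<open>U\<close> force the first coordinates of the support into \<open>Z\<close>.\<close>
  have "A \<subseteq> Z"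
  proof
    fix x assume "x \<in> A"
    then obtain y where "(x, y) \<in> Poly_Mapping.keys \<mu>" by (auto simp: A_def)
    then have "x \<in> Poly_Mapping.keys (slice_fst \<mu> y)" by (simp add: in_keys_iff)
    then show "x \<in> Z" using fstU[of y] Z by (auto simp: dmeasures_def)
  qed
  then have G_sym: "G y y' = G y' y" for y y'
    unfolding G_def using sym by (subst sum.swap) (intro sum.cong refl, auto simp: mult_ac)
  have G_energy: "energy P (\<Sum>y\<in>B. scale (f y) (slice_fst \<mu> y)) = (\<Sum>y'\<in>B. \<Sum>y\<in>B. f y * f y' * G y y')" for f
    using energy_linear_combination[OF fin(1), of "B" "slice_fst \<mu>" P f] keys_slice_fst[of \<mu>]
    by (simp add: G_def A_def)
  have nonneg: "energy P u \<ge> 0" if "u \<in> U" for u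
    using U(2) that by (cases "u = 0") (auto simp: positive_on_def less_imp_le)
  have psd: "(\<Sum>y\<in>B. \<Sum>y'\<in>B. f y * f y' * G y y') \<ge> 0" for f
    using nonneg[OF linear_space_sum[OF U(1) fin(2), of "slice_fst \<mu>" f, OF fstU]]
    by (subst sum.swap) (simp add: G_energy)
  obtain c w where c: "\<And>y y'. y \<in> B \<Longrightarrow> y' \<in> B \<Longrightarrow> G y y' = (\<Sum>r\<in>B. c r y * c r y')"
    and w: "\<And>r y. r \<in> B \<Longrightarrow> y \<in> B \<Longrightarrow> c r y = (\<Sum>s\<in>B. w r s * G s y)"
    using psd_rank_one_decomposition[OF fin(2,2) subset_refl G_sym psd] by blast
  \<comment> \<open>Expanding \<open>G s y\<close> in the formula for \<open>c r y\<close> and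
    collecting the factors \<open>?l (x', y)\<close> gives these coefficients. Thus
    \<open>c r\<close> becomes a measure that visibly lies in \<open>V\<close>.\<close>
  define \<nu> where "\<nu> = (\<lambda>r. \<Sum>x'\<in>A. scale (\<Sum>s\<in>B. w r s * (\<Sum>x\<in>A. P x x' * ?l (x, s))) (slice_snd \<mu> x'))"
  have \<nu>V: "\<nu> r \<in> V" for r
    unfolding \<nu>_def by (rule linear_space_sum[OF V(1) fin(1) sndV])
  have lookup_\<nu>: "Poly_Mapping.lookup (\<nu> r) y = c r y" if "r \<in> B" "y \<in> B" for r y
  proof -
    have "Poly_Mapping.lookup (\<nu> r) y = (\<Sum>x'\<in>A. \<Sum>s\<in>B. w r s * (\<Sum>x\<in>A. P x x' * ?l (x, s) * ?l (x', y)))"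
      by (simp add: \<nu>_def lookup_sum sum_distrib_right sum_distrib_left mult_ac)
    also have "\<dots> = (\<Sum>s\<in>B. w r s * G s y)"
      by (subst sum.swap) (simp add: G_def sum_distrib_left)
    finally show ?thesis using w that by simp
  qed
  \<comment> \<open>The vectors \<open>c r\<close> are controlled on \<open>B\<close> only; off
    \<open>B\<close> every slice, and with it \<open>\<nu> r\<close>, is zero.\<close>
  have keys_\<nu>: "Poly_Mapping.keys (\<nu> r) \<subseteq> B" for r
  proof
    fix y assume "y \<in> Poly_Mapping.keys (\<nu> r)"
    then have "Poly_Mapping.lookup (\<nu> r) y \<noteq> 0" by (simp add: in_keys_iff)
    moreover have "Poly_Mapping.lookup (\<nu> r) y = 0" if "\<forall>x'. ?l (x', y) = 0"
      using that by (simp add: \<nu>_def lookup_sum)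
    ultimately obtain x' where "?l (x', y) \<noteq> 0" by blast
    then show "y \<in> B" by (force simp: B_def in_keys_iff)
  qed
  have "energy (prod_kernel P Q) \<mu> = (\<Sum>y'\<in>B. \<Sum>y\<in>B. Q y y' * G y y')"
    by (simp add: energy_product[OF fin keys] G_def)
  also have "\<dots> = (\<Sum>y'\<in>B. \<Sum>y\<in>B. \<Sum>r\<in>B. Q y y' * c r y * c r y')"
    using c by (simp add: sum_distrib_left mult_ac)
  also have "\<dots> = (\<Sum>y'\<in>B. \<Sum>r\<in>B. \<Sum>y\<in>B. Q y y' * c r y * c r y')"
    by (intro sum.cong refl sum.swap)
  also have "\<dots> = (\<Sum>r\<in>B. \<Sum>y'\<in>B. \<Sum>y\<in>B. Q y y' * c r y * c r y')"
    by (rule sum.swap)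
  also have "\<dots> = (\<Sum>r\<in>B. energy Q (\<nu> r))"
    by (simp add: energy_superset[OF fin(2) keys_\<nu>] lookup_\<nu>)
  also have "\<dots> > 0"
  proof -
    \<comment> \<open>Strictness: a nonzero slice at \<open>y\<close> has positive energy
      \<open>G y y\<close>, which is the sum of the squares of the \<open>c r y\<close>. Hence some
      \<open>\<nu> r\<close> is nonzero.\<close>
    obtain x y where xy: "?l (x, y) \<noteq> 0"
      using \<mu>(2) by (metis lookup_zero poly_mapping_eqI surj_pair)
    then have "y \<in> B" by (force simp: B_def in_keys_iff)
    have "Poly_Mapping.lookup (slice_fst \<mu> y) x \<noteq> 0" using xy by simp
    then have "slice_fst \<mu> y \<noteq> 0" by (metis lookup_zero)
    then have "energy P (slice_fst \<mu> y) > 0" using U(2) fstU by (auto simp: positive_on_def)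
    also have "energy P (slice_fst \<mu> y) = G y y"
      by (simp add: energy_superset[OF fin(1) keys_slice_fst[of \<mu>, folded A_def]] G_def)
    finally have "(\<Sum>r\<in>B. c r y * c r y) \<noteq> 0" using c \<open>y \<in> B\<close> by simp
    then obtain r where r: "r \<in> B" "c r y \<noteq> 0"
      by (auto elim: sum.not_neutral_contains_not_neutral)
    then have "Poly_Mapping.lookup (\<nu> r) y \<noteq> 0" using lookup_\<nu> \<open>y \<in> B\<close> by simp
    then have "\<nu> r \<noteq> 0" by (metis lookup_zero)
    then have "energy Q (\<nu> r) > 0" using V(2) \<nu>V by (auto simp: positive_on_def)
    moreover have "energy Q (\<nu> r) \<ge> 0" for r
      using V(2) \<nu>V[of r] by (cases "\<nu> r = 0") (auto simp: positive_on_def less_imp_le)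
    ultimately show ?thesis using r(1) fin(2) by (intro sum_pos2) auto
  qed
  finally show "energy (prod_kernel P Q) \<mu> > 0" .
qed

section \<open>The spaces \<open>\<M>\<^sub>k\<close> and \<open>\<M>\<^sub>a\<^sub>,\<^sub>b\<close>\<close>

lemma keys_Mk: "\<mu> \<in> Mk k n X \<Longrightarrow> Poly_Mapping.keys \<mu> \<subseteq> prodset n X"
  by (simp add: Mk_def dmeasures_def)

lemma dmeasure_Mk:
  assumes "\<mu> \<in> Mk k n X" "\<forall>i\<in>{1..n}. A i \<subseteq> X i" "card {i\<in>{1..n}. A i = X i} \<ge> n - k + 1"
  shows "dmeasure \<mu> (prodset n A) = 0"
  using assms unfolding Mk_def by blast

lemma linear_space_Mk: "linear_space (Mk k n X)"
proof -
  have "\<mu> + scale c \<nu> \<in> Mk k n X" if \<mu>: "\<mu> \<in> Mk k n X" and \<nu>: "\<nu> \<in> Mk k n X" for \<mu> \<nu> c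
  proof -
    let ?S = "Poly_Mapping.keys \<mu> \<union> Poly_Mapping.keys \<nu>"
    have keys: "Poly_Mapping.keys (\<mu> + scale c \<nu>) \<subseteq> ?S"
      by (auto simp: in_keys_iff lookup_add)
    have "dmeasure (\<mu> + scale c \<nu>) A = dmeasure \<mu> A + c * dmeasure \<nu> A" for A
      using keys by (simp add: dmeasure_superset[of ?S] lookup_add sum.distrib sum_distrib_left algebra_simps
        del: sum_mult_of_bool_eq sum_of_bool_mult_eq)
    then have "dmeasure (\<mu> + scale c \<nu>) (prodset n A) = 0"
      if "\<forall>i\<in>{1..n}. A i \<subseteq> X i" "card {i\<in>{1..n}. A i = X i} \<ge> n - k + 1" for A
      by (simp only: dmeasure_Mk[OF \<mu> that] dmeasure_Mk[OF \<nu> that] mult_zero_right add_0)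
    moreover have "Poly_Mapping.keys (\<mu> + scale c \<nu>) \<subseteq> prodset n X"
      using keys keys_Mk[OF \<mu>] keys_Mk[OF \<nu>] by blast
    ultimately show ?thesis unfolding Mk_def dmeasures_def by blast
  qed
  then show ?thesis by (auto simp: linear_space_def Mk_def dmeasures_def dmeasure_def)
qed

text \<open>Used to test a measure on boxes with a one-point side, which see a single slice.\<close>

lemma prodset_singletons:
  assumes "y \<in> prodset m Y"
  shows "prodset m (\<lambda>j. {y j}) = {y}"
proof
  show "prodset m (\<lambda>j. {y j}) \<subseteq> {y}"
    using assms by (auto intro!: PiE_ext[of _ "{1..m}" "\<lambda>j. {y j}" _ ])
  show "{y} \<subseteq> prodset m (\<lambda>j. {y j})"
    using assms by auto
qed

text \<open>Fubini on boxes, in both orders; it carries vanishing from slices to boxes.\<close>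

lemma dmeasure_Times:
  fixes \<mu> :: "'x \<times> 'y \<Rightarrow>\<^sub>0 real"
  defines "A' \<equiv> fst ` Poly_Mapping.keys \<mu>" and "B' \<equiv> snd ` Poly_Mapping.keys \<mu>"
  shows "dmeasure \<mu> (A \<times> B) = (\<Sum>y\<in>B'. of_bool (y \<in> B) * dmeasure (slice_fst \<mu> y) A)"
    and "dmeasure \<mu> (A \<times> B) = (\<Sum>x\<in>A'. of_bool (x \<in> A) * dmeasure (slice_snd \<mu> x) B)"
proof -
  have keys: "Poly_Mapping.keys \<mu> \<subseteq> A' \<times> B'" by (force simp: A'_def B'_def)
  have fin: "finite A'" "finite B'" by (simp_all add: A'_def B'_def)
  have eq: "dmeasure \<mu> (A \<times> B)
      = (\<Sum>x\<in>A'. \<Sum>y\<in>B'. of_bool (x \<in> A) * of_bool (y \<in> B) * Poly_Mapping.lookup \<mu> (x, y))"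
    using fin by (simp add: dmeasure_superset[OF _ keys] sum.cartesian_product' of_bool_conj
      del: sum_mult_of_bool_eq sum_of_bool_mult_eq)
  show "dmeasure \<mu> (A \<times> B) = (\<Sum>x\<in>A'. of_bool (x \<in> A) * dmeasure (slice_snd \<mu> x) B)"
    using fin keys_slice_snd[of \<mu>] unfolding eq
    by (simp add: dmeasure_superset[of B'] sum_distrib_left mult_ac del: sum_mult_of_bool_eq sum_of_bool_mult_eq flip: B'_def)
  show "dmeasure \<mu> (A \<times> B) = (\<Sum>y\<in>B'. of_bool (y \<in> B) * dmeasure (slice_fst \<mu> y) A)"
    using fin keys_slice_fst[of \<mu>] unfolding eq
    by (subst sum.swap) (simp add: dmeasure_superset[of A'] sum_distrib_left mult_ac del: sum_mult_of_bool_eq sum_of_bool_mult_eq flip: A'_def)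
qed

text \<open>At most one term of the Fubini sum survives. If the point lies outside the projected
  support, its slice is zero and both sides vanish.\<close>

lemma dmeasure_Times_singleton:
  shows "dmeasure \<mu> (A \<times> {y}) = dmeasure (slice_fst \<mu> y) A"
    and "dmeasure \<mu> ({x} \<times> B) = dmeasure (slice_snd \<mu> x) B"
proof -
  have "slice_fst \<mu> y = 0" if "y \<notin> snd ` Poly_Mapping.keys \<mu>"
    using that by (intro poly_mapping_eqI) (force simp: in_keys_iff)
  then show "dmeasure \<mu> (A \<times> {y}) = dmeasure (slice_fst \<mu> y) A"
    by (cases "y \<in> snd ` Poly_Mapping.keys \<mu>")
      (auto simp: dmeasure_Times(1) dmeasure_def[of 0] of_bool_def if_distrib[where f="\<lambda>c. c * _"] cong: if_cong)
  have "slice_snd \<mu> x = 0" if "x \<notin> fst ` Poly_Mapping.keys \<mu>"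
    using that by (intro poly_mapping_eqI) (force simp: in_keys_iff)
  then show "dmeasure \<mu> ({x} \<times> B) = dmeasure (slice_snd \<mu> x) B"
    by (cases "x \<in> fst ` Poly_Mapping.keys \<mu>")
      (auto simp: dmeasure_Times(2) dmeasure_def[of 0] of_bool_def if_distrib[where f="\<lambda>c. c * _"] cong: if_cong)
qed

text \<open>Enough full sides in one factor leave the box in the other factor arbitrary. Shrinking
  that box to a point yields the condition on each slice; Fubini in the matching order gives the
  converse.\<close>

lemma Mab_eq_tensor_space: "Mab a b n X m Y = tensor_space (Mk a n X) (Mk b m Y)"
proof (intro equalityI subsetI)
  fix \<mu> assume \<mu>: "\<mu> \<in> Mab a b n X m Y"
  then have keys: "Poly_Mapping.keys \<mu> \<subseteq> prodset n X \<times> prodset m Y"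
    by (simp add: Mab_def dmeasures_def)
  have zero: "dmeasure \<mu> (prodset n A \<times> prodset m B) = 0"
    if "\<forall>i\<in>{1..n}. A i \<subseteq> X i" "\<forall>j\<in>{1..m}. B j \<subseteq> Y j"
      "card {i\<in>{1..n}. A i = X i} \<ge> n - a + 1 \<or> card {j\<in>{1..m}. B j = Y j} \<ge> m - b + 1" for A B
    using \<mu> that unfolding Mab_def by blast
  have "slice_fst \<mu> y \<in> Mk a n X" for y
  proof (cases "y \<in> prodset m Y")
    case True
    have "dmeasure (slice_fst \<mu> y) (prodset n A) = 0"
      if "\<forall>i\<in>{1..n}. A i \<subseteq> X i" "card {i\<in>{1..n}. A i = X i} \<ge> n - a + 1" for A
    proof -
      have "dmeasure \<mu> (prodset n A \<times> prodset m (\<lambda>j. {y j})) = 0"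
        using that True by (intro zero) auto
      then show ?thesis by (simp only: prodset_singletons[OF True] dmeasure_Times_singleton)
    qed
    moreover have "Poly_Mapping.keys (slice_fst \<mu> y) \<subseteq> prodset n X"
      using keys_slice_fst[of \<mu> y] keys by fastforce
    ultimately show ?thesis by (auto simp: Mk_def dmeasures_def)
  next
    case False
    then have "(x, y) \<notin> Poly_Mapping.keys \<mu>" for x using keys by blast
    then have "slice_fst \<mu> y = 0" by (intro poly_mapping_eqI) (simp add: in_keys_iff)
    then show ?thesis using linear_space_Mk by (auto simp: linear_space_def)
  qed
  moreover have "slice_snd \<mu> x \<in> Mk b m Y" for x
  proof (cases "x \<in> prodset n X")
    case True
    have "dmeasure (slice_snd \<mu> x) (prodset m B) = 0"
      if "\<forall>j\<in>{1..m}. B j \<subseteq> Y j" "card {j\<in>{1..m}. B j = Y j} \<ge> m - b + 1" for B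
    proof -
      have "dmeasure \<mu> (prodset n (\<lambda>i. {x i}) \<times> prodset m B) = 0"
        using that True by (intro zero) auto
      then show ?thesis by (simp only: prodset_singletons[OF True] dmeasure_Times_singleton)
    qed
    moreover have "Poly_Mapping.keys (slice_snd \<mu> x) \<subseteq> prodset m Y"
      using keys_slice_snd[of \<mu> x] keys by fastforce
    ultimately show ?thesis by (auto simp: Mk_def dmeasures_def)
  next
    case False
    then have "(x, y) \<notin> Poly_Mapping.keys \<mu>" for y using keys by blast
    then have "slice_snd \<mu> x = 0" by (intro poly_mapping_eqI) (simp add: in_keys_iff)
    then show ?thesis using linear_space_Mk by (auto simp: linear_space_def)
  qed
  ultimately show "\<mu> \<in> tensor_space (Mk a n X) (Mk b m Y)" by (simp add: tensor_space_def)
next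
  fix \<mu> assume "\<mu> \<in> tensor_space (Mk a n X) (Mk b m Y)"
  then have fst: "slice_fst \<mu> y \<in> Mk a n X" and snd: "slice_snd \<mu> x \<in> Mk b m Y" for x y
    by (auto simp: tensor_space_def)
  have "(x, y) \<in> prodset n X \<times> prodset m Y" if "(x, y) \<in> Poly_Mapping.keys \<mu>" for x y
  proof -
    have "x \<in> Poly_Mapping.keys (slice_fst \<mu> y)" "y \<in> Poly_Mapping.keys (slice_snd \<mu> x)"
      using that by (simp_all add: in_keys_iff)
    then show ?thesis using keys_Mk[OF fst[of y]] keys_Mk[OF snd[of x]] by blast
  qed
  then have "\<mu> \<in> dmeasures (prodset n X \<times> prodset m Y)" by (auto simp: dmeasures_def)
  moreover have "dmeasure \<mu> (prodset n A \<times> prodset m B) = 0"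
    if A: "\<forall>i\<in>{1..n}. A i \<subseteq> X i" and B: "\<forall>j\<in>{1..m}. B j \<subseteq> Y j"
      and full: "card {i\<in>{1..n}. A i = X i} \<ge> n - a + 1 \<or> card {j\<in>{1..m}. B j = Y j} \<ge> m - b + 1" for A B
    using full
  proof
    assume "card {i\<in>{1..n}. A i = X i} \<ge> n - a + 1"
    then have "dmeasure (slice_fst \<mu> y) (prodset n A) = 0" for y
      using dmeasure_Mk[OF fst A] by blast
    then show ?thesis by (subst dmeasure_Times(1)) simp
  next
    assume "card {j\<in>{1..m}. B j = Y j} \<ge> m - b + 1"
    then have "dmeasure (slice_snd \<mu> x) (prodset m B) = 0" for x
      using dmeasure_Mk[OF snd B] by blast
    then show ?thesis by (subst dmeasure_Times(2)) simp
  qed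
  ultimately show "\<mu> \<in> Mab a b n X m Y" unfolding Mab_def by blast
qed

section \<open>Symmetric kernels and strict positivity\<close>

lemma n_symmetric_commute:
  assumes "n_symmetric n X K" "x \<in> prodset n X" "y \<in> prodset n X"
  shows "K x y = K y x"
proof -
  \<comment> \<open>The constant selection \<open>\<alpha> = 2\<close> exchanges all coordinates at
    once, since \<open>3 - 2 = 1\<close>. The restrictions disappear because points of the product
    are extensional.\<close>
  let ?z = "\<lambda>p :: nat. if p = 1 then x else y"
  have "K (?z 1) (?z 2) = K (\<lambda>i\<in>{1..n}. ?z 2 i) (\<lambda>i\<in>{1..n}. ?z (3 - 2) i)"
    using assms unfolding n_symmetric_def by (elim allE[of _ ?z] allE[of _ "\<lambda>_. 2"]) auto
  moreover have "restrict x {1..n} = x" "restrict y {1..n} = y"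
    using assms(2,3) by (auto intro: extensional_restrict simp: PiE_def)
  ultimately show ?thesis by simp
qed

lemma n_symmetric_scale: "n_symmetric n X K \<Longrightarrow> n_symmetric n X (\<lambda>u v. c * K u v)"
  unfolding n_symmetric_def by (blast intro: arg_cong[where f="(*) c"])

text \<open>Since the zero measure has energy zero, nonnegativity with equality only at zero amounts
  to strict positivity away from zero.\<close>

lemma SPDI_iff_positive_on:
  "SPDI k n X K \<longleftrightarrow> n_symmetric n X K \<and> positive_on (Mk k n X) (\<lambda>u v. (-1) ^ k * K u v)"
proof -
  have "(\<forall>\<mu>\<in>Mk k n X. 0 \<le> energy K' \<mu>) \<and> (\<forall>\<mu>\<in>Mk k n X. energy K' \<mu> = 0 \<longrightarrow> \<mu> = 0)
     \<longleftrightarrow> positive_on (Mk k n X) K'" for K'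
    unfolding positive_on_def by (metis energy_zero order_less_irrefl order.order_iff_strict)
  then show ?thesis
    unfolding SPDI_def PDI_def by (auto simp flip: energy_def)
qed

theorem theorem43:
  fixes n m a b k :: nat
    and X :: "nat \<Rightarrow> 'a set" and Y :: "nat \<Rightarrow> 'b set"
    and I :: "(nat \<Rightarrow> 'a) \<Rightarrow> (nat \<Rightarrow> 'a) \<Rightarrow> real"
    and L :: "(nat \<Rightarrow> 'b) \<Rightarrow> (nat \<Rightarrow> 'b) \<Rightarrow> real"
  assumes "\<And>i. i \<in> {1..n} \<Longrightarrow> X i \<noteq> {}" and "\<And>j. j \<in> {1..m} \<Longrightarrow> Y j \<noteq> {}"
    and "a \<le> n" and "b \<le> m" and "k \<le> n + m"
    and "n_symmetric n X I" and "n_symmetric m Y L"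
    and nondegenerate: "Mk a n X = {0} \<longleftrightarrow> Mk b m Y = {0}"
  shows "(\<forall>\<mu> \<in> Mab a b n X m Y. \<mu> \<noteq> 0 \<longrightarrow>
            dintegral \<mu> (\<lambda>v. dintegral \<mu> (\<lambda>u. (-1) ^ (a + b) * prod_kernel I L u v)) > 0)
     \<longleftrightarrow> (\<exists>l \<in> {0, 1 :: nat}. SPDI a n X (\<lambda>u v. (-1) ^ l * I u v) \<and>
                               SPDI b m Y (\<lambda>u v. (-1) ^ l * L u v))"
proof -
  \<comment> \<open>The signs belonging to \<open>a\<close> and \<open>b\<close> are absorbed into
    the kernels, so that only the common sign \<open>l\<close> remains to be found.\<close>
  define P where "P = (\<lambda>u v. (-1) ^ a * I u v)"
  define Q where "Q = (\<lambda>u v. (-1) ^ b * L u v)"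
  let ?U = "Mk a n X" and ?V = "Mk b m Y"
  have kernel: "(\<lambda>u v. (-1) ^ (a + b) * prod_kernel I L u v) = prod_kernel P Q"
    by (auto simp: fun_eq_iff prod_kernel_def P_def Q_def power_add)
  have "(\<forall>\<mu>\<in>Mab a b n X m Y. \<mu> \<noteq> 0 \<longrightarrow>
      dintegral \<mu> (\<lambda>v. dintegral \<mu> (\<lambda>u. (-1) ^ (a + b) * prod_kernel I L u v)) > 0)
    \<longleftrightarrow> positive_on (tensor_space ?U ?V) (prod_kernel P Q)"
    unfolding positive_on_def kernel[symmetric] energy_def Mab_eq_tensor_space ..
  moreover have "SPDI a n X (\<lambda>u v. (-1) ^ l * I u v) \<longleftrightarrow> positive_on ?U (\<lambda>u v. (-1) ^ l * P u v)"
    "SPDI b m Y (\<lambda>u v. (-1) ^ l * L u v) \<longleftrightarrow> positive_on ?V (\<lambda>u v. (-1) ^ l * Q u v)" for l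
    using assms(6,7) by (simp_all add: SPDI_iff_positive_on n_symmetric_scale P_def Q_def mult.left_commute)
  moreover have "positive_on (tensor_space ?U ?V) (prod_kernel P Q) \<longleftrightarrow>
    (\<exists>l\<in>{0, 1 :: nat}. positive_on ?U (\<lambda>u v. (-1) ^ l * P u v) \<and> positive_on ?V (\<lambda>u v. (-1) ^ l * Q u v))"
  proof
    assume pos: "positive_on (tensor_space ?U ?V) (prod_kernel P Q)"
    \<comment> \<open>Positivity is tested on the nonzero product measure
      \<open>tensor u v\<close>.\<close>
    have PQ: "energy P u * energy Q v > 0" if "u \<in> ?U" "u \<noteq> 0" "v \<in> ?V" "v \<noteq> 0" for u v
      using pos that tensor_in_tensor_space[OF linear_space_Mk linear_space_Mk] tensor_nonzero
      by (fastforce simp: positive_on_def simp flip: energy_tensor)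
    show "\<exists>l\<in>{0, 1 :: nat}. positive_on ?U (\<lambda>u v. (-1) ^ l * P u v) \<and> positive_on ?V (\<lambda>u v. (-1) ^ l * Q u v)"
    proof (cases "?U = {0}")
      case True
      \<comment> \<open>Both spaces are trivial here, so either sign works vacuously.\<close>
      then show ?thesis using nondegenerate by (auto simp: positive_on_def)
    next
      case False
      then have "?V \<noteq> {0}" using nondegenerate by simp
      moreover have "0 \<in> ?U" "0 \<in> ?V" using linear_space_Mk by (auto simp: linear_space_def)
      ultimately obtain u0 v0 where "u0 \<in> ?U" "u0 \<noteq> 0" "v0 \<in> ?V" "v0 \<noteq> 0" using False by blast
      \<comment> \<open>Fixing \<open>v0\<close> compares every energy on \<open>?U\<close> with
        that of \<open>v0\<close>, fixing \<open>u0\<close> does so on \<open>?V\<close>, and the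
        last fact links the two reference signs.\<close>
      note PQ0 = PQ[OF _ _ this(3,4)] PQ[OF this(1,2)] PQ[OF this]
      show ?thesis
      proof (cases "energy P u0 > 0")
        case True
        then have "positive_on ?U P \<and> positive_on ?V Q"
          using PQ0 by (auto simp: positive_on_def zero_less_mult_iff)
        then show ?thesis by simp
      next
        case False
        \<comment> \<open>As a factor of a positive product, \<open>energy P u0\<close> is nonzero,
          hence negative here, and \<open>l = 1\<close> works.\<close>
        then have "positive_on ?U (\<lambda>u v. (-1) * P u v) \<and> positive_on ?V (\<lambda>u v. (-1) * Q u v)"
          using PQ0 unfolding positive_on_def energy_scale by (auto simp: zero_less_mult_iff)
        then show ?thesis by simp
      qed
    qed
  next
    assume "\<exists>l\<in>{0, 1 :: nat}. positive_on ?U (\<lambda>u v. (-1) ^ l * P u v) \<and> positive_on ?V (\<lambda>u v. (-1) ^ l * Q u v)"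
    then obtain l :: nat where l: "positive_on ?U (\<lambda>u v. (-1) ^ l * P u v)" "positive_on ?V (\<lambda>u v. (-1) ^ l * Q u v)"
      by blast
    have "?U \<subseteq> dmeasures (prodset n X)" by (auto simp: Mk_def)
    moreover have "(-1) ^ l * P x x' = (-1) ^ l * P x' x" if "x \<in> prodset n X" "x' \<in> prodset n X" for x x'
      using n_symmetric_commute[OF assms(6) that] by (simp add: P_def)
    ultimately have "positive_on (tensor_space ?U ?V)
        (prod_kernel (\<lambda>u v. (-1) ^ l * P u v) (\<lambda>u v. (-1) ^ l * Q u v))"
      by (intro positive_on_tensor_space[OF linear_space_Mk l(1) linear_space_Mk l(2)]) auto
    \<comment> \<open>The two signs multiply to \<open>(-1) ^ (2 * l) = 1\<close>, so twisting both
      kernels leaves their product unchanged.\<close>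
    moreover have "prod_kernel (\<lambda>u v. (-1) ^ l * P u v) (\<lambda>u v. (-1) ^ l * Q u v) = prod_kernel P Q"
      by (auto simp: fun_eq_iff prod_kernel_def mult.assoc mult.left_commute simp flip: power_add mult_2)
    ultimately show "positive_on (tensor_space ?U ?V) (prod_kernel P Q)" by simp
  qed
  ultimately show ?thesis by simp
qed

end
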